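(* Let $k$ be a field and let $R$ be an almost PI $k$-algebra which satisfies the ascending chain condition on semiprime ideals. Then $R$ has only countably many height 1 prime ideals.
   Context: All algebras are associative with 1. PI means satisfying a (nontrivial) polynomial identity over $k$. A $k$-algebra $R$ is almost PI if $R$ is not PI and $R/I$ is PI for every nonzero two-sided ideal $I$ of $R$; such an algebra is prime. Countably many means at most $\aleph_0$. The height of a prime ideal $P$ is the supremum of lengths $n$ of strictly descending chains $P=P_0\supsetneq P_1\supsetneq\cdots\supsetneq P_n$ of prime ideals. *)

theory Defs
  imports "HOL-Algebra.Algebra" "HOL-Library.Extended_Nat" "HOL-Library.Countable_Set"
begin

text \<open>
  Associative unital algebras over a field. HOL-Algebra's locale \<open>algebra\<close> demands a
  commutative algebra, so a noncommutative version is needed.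
\<close>

locale assoc_algebra = module K A + field K + A?: ring A
  for K (structure) and A (structure) +
  assumes smult_mult_left:
      "\<lbrakk>a \<in> carrier K; x \<in> carrier A; y \<in> carrier A\<rbrakk> \<Longrightarrow>
        (a \<odot>\<^bsub>A\<^esub> x) \<otimes>\<^bsub>A\<^esub> y = a \<odot>\<^bsub>A\<^esub> (x \<otimes>\<^bsub>A\<^esub> y)"
    and smult_mult_right:
      "\<lbrakk>a \<in> carrier K; x \<in> carrier A; y \<in> carrier A\<rbrakk> \<Longrightarrow>
        x \<otimes>\<^bsub>A\<^esub> (a \<odot>\<^bsub>A\<^esub> y) = a \<odot>\<^bsub>A\<^esub> (x \<otimes>\<^bsub>A\<^esub> y)"

text \<open>
  The quotient ring of HOL-Algebra carries no scalar action; it is extended here by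
  \<open>c \<odot> (I + x) = I + c \<odot> x\<close>, written as a union over representatives in the style of
  \<^const>\<open>rcoset_mult\<close>.
\<close>

definition quot_algebra ::
  "('k, 'a, 'm) module_scheme \<Rightarrow> 'a set \<Rightarrow> ('k, 'a set) module"
  where "quot_algebra A I =
    ring.extend (A Quot I)
      (module.fields (\<lambda>c U. \<Union>x\<in>U. I +>\<^bsub>A\<^esub> (c \<odot>\<^bsub>A\<^esub> x)))"

text \<open>
  Elements of the free algebra \<open>K\<langle>x\<^sub>0, x\<^sub>1, \<dots>\<rangle>\<close>: finitely supported
  families of coefficients indexed by words in the variables.
\<close>

definition nc_polys :: "('k, 'n) ring_scheme \<Rightarrow> (nat list \<Rightarrow> 'k) set"
  where "nc_polys K =
    {f. (\<forall>w. f w \<in> carrier K) \<and> finite {w. f w \<noteq> \<zero>\<^bsub>K\<^esub>}}"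

definition word_eval :: "('k, 'a, 'm) module_scheme \<Rightarrow> (nat \<Rightarrow> 'a) \<Rightarrow> nat list \<Rightarrow> 'a"
  where "word_eval A s w = foldr (\<lambda>i r. s i \<otimes>\<^bsub>A\<^esub> r) w \<one>\<^bsub>A\<^esub>"

definition nc_eval ::
  "('k, 'n) ring_scheme \<Rightarrow> ('k, 'a, 'm) module_scheme \<Rightarrow> (nat \<Rightarrow> 'a) \<Rightarrow> (nat list \<Rightarrow> 'k) \<Rightarrow> 'a"
  where "nc_eval K A s f =
    (\<Oplus>\<^bsub>A\<^esub>w\<in>{w. f w \<noteq> \<zero>\<^bsub>K\<^esub>}. f w \<odot>\<^bsub>A\<^esub> word_eval A s w)"

definition PI_algebra :: "('k, 'n) ring_scheme \<Rightarrow> ('k, 'a, 'm) module_scheme \<Rightarrow> bool"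
  where "PI_algebra K A \<longleftrightarrow>
    (\<exists>f\<in>nc_polys K. f \<noteq> (\<lambda>w. \<zero>\<^bsub>K\<^esub>) \<and>
      (\<forall>s. range s \<subseteq> carrier A \<longrightarrow> nc_eval K A s f = \<zero>\<^bsub>A\<^esub>))"

definition almost_PI :: "('k, 'n) ring_scheme \<Rightarrow> ('k, 'a, 'm) module_scheme \<Rightarrow> bool"
  where "almost_PI K A \<longleftrightarrow>
    \<not> PI_algebra K A \<and>
    (\<forall>I. ideal I A \<and> I \<noteq> {\<zero>\<^bsub>A\<^esub>} \<longrightarrow> PI_algebra K (quot_algebra A I))"

text \<open>
  Prime and semiprime two-sided ideals of a noncommutative ring, by products of ideals;
  \<^const>\<open>primeideal\<close> is elementwise and confined to commutative rings. With this convention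
  the whole ring is semiprime but not prime.
\<close>

definition nc_prime_ideal :: "'a set \<Rightarrow> ('a, 'm) ring_scheme \<Rightarrow> bool"
  where "nc_prime_ideal P R \<longleftrightarrow>
    ideal P R \<and> P \<noteq> carrier R \<and>
    (\<forall>I J. ideal I R \<and> ideal J R \<and> I \<cdot>\<^bsub>R\<^esub> J \<subseteq> P \<longrightarrow> I \<subseteq> P \<or> J \<subseteq> P)"

definition nc_semiprime_ideal :: "'a set \<Rightarrow> ('a, 'm) ring_scheme \<Rightarrow> bool"
  where "nc_semiprime_ideal Q R \<longleftrightarrow>
    ideal Q R \<and> (\<forall>I. ideal I R \<and> I \<cdot>\<^bsub>R\<^esub> I \<subseteq> Q \<longrightarrow> I \<subseteq> Q)"

definition acc_semiprime :: "('a, 'm) ring_scheme \<Rightarrow> bool"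
  where "acc_semiprime R \<longleftrightarrow>
    (\<forall>Q :: nat \<Rightarrow> 'a set.
      (\<forall>n. nc_semiprime_ideal (Q n) R \<and> Q n \<subseteq> Q (Suc n)) \<longrightarrow>
      (\<exists>N. \<forall>n\<ge>N. Q n = Q N))"

definition prime_height :: "('a, 'm) ring_scheme \<Rightarrow> 'a set \<Rightarrow> enat"
  where "prime_height R P =
    Sup {enat n | n. \<exists>C :: nat \<Rightarrow> 'a set. C 0 = P \<and>
      (\<forall>i\<le>n. nc_prime_ideal (C i) R) \<and> (\<forall>i<n. C (Suc i) \<subset> C i)}"

subsection \<open>The quotient algebra is an algebra\<close>

lemma quot_algebra_simps [simp]:
  "carrier (quot_algebra A I) = carrier (A Quot I)"
  "monoid.mult (quot_algebra A I) = monoid.mult (A Quot I)"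
  "monoid.one (quot_algebra A I) = monoid.one (A Quot I)"
  "ring.zero (quot_algebra A I) = ring.zero (A Quot I)"
  "ring.add (quot_algebra A I) = ring.add (A Quot I)"
  "smult (quot_algebra A I) = (\<lambda>c U. \<Union>x\<in>U. I +>\<^bsub>A\<^esub> (c \<odot>\<^bsub>A\<^esub> x))"
  by (simp_all add: quot_algebra_def ring.defs module.defs)

context assoc_algebra
begin

lemma ideal_smult_closed:
  assumes "ideal I A" "c \<in> carrier K" "x \<in> I"
  shows "c \<odot>\<^bsub>A\<^esub> x \<in> I"
proof -
  have x: "x \<in> carrier A" using assms by (meson ideal.Icarr)
  have "c \<odot>\<^bsub>A\<^esub> x = (c \<odot>\<^bsub>A\<^esub> \<one>\<^bsub>A\<^esub>) \<otimes>\<^bsub>A\<^esub> x"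
    using smult_mult_left[of c "\<one>\<^bsub>A\<^esub>" x] x assms by simp
  then show ?thesis using assms by (simp add: ideal.I_l_closed)
qed

lemma quot_smult_coset:
  assumes I: "ideal I A" and c: "c \<in> carrier K" and x: "x \<in> carrier A"
  shows "c \<odot>\<^bsub>quot_algebra A I\<^esub> (I +>\<^bsub>A\<^esub> x) = I +>\<^bsub>A\<^esub> (c \<odot>\<^bsub>A\<^esub> x)"
proof -
  interpret I: ideal I A by fact
  have eq: "I +>\<^bsub>A\<^esub> (c \<odot>\<^bsub>A\<^esub> y) = I +>\<^bsub>A\<^esub> (c \<odot>\<^bsub>A\<^esub> x)"
    if y: "y \<in> I +>\<^bsub>A\<^esub> x" for y
  proof -
    obtain i where i: "i \<in> I" "y = i \<oplus>\<^bsub>A\<^esub> x"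
      using y by (auto simp: a_r_coset_def')
    have "c \<odot>\<^bsub>A\<^esub> y = c \<odot>\<^bsub>A\<^esub> i \<oplus>\<^bsub>A\<^esub> c \<odot>\<^bsub>A\<^esub> x"
      using i c x by (simp add: smult_r_distr I.Icarr)
    then have "c \<odot>\<^bsub>A\<^esub> y \<in> I +>\<^bsub>A\<^esub> (c \<odot>\<^bsub>A\<^esub> x)"
      using ideal_smult_closed[OF I c i(1)] by (auto simp: a_r_coset_def')
    then show ?thesis
      by (rule I.a_repr_independence'[OF _ smult_closed[OF c x], symmetric])
  qed
  have "c \<odot>\<^bsub>quot_algebra A I\<^esub> (I +>\<^bsub>A\<^esub> x) =
      (\<Union>y\<in>I +>\<^bsub>A\<^esub> x. I +>\<^bsub>A\<^esub> (c \<odot>\<^bsub>A\<^esub> x))"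
    unfolding quot_algebra_simps by (rule SUP_cong[OF refl]) (rule eq)
  also have "\<dots> = I +>\<^bsub>A\<^esub> (c \<odot>\<^bsub>A\<^esub> x)"
    using I.a_rcos_self[OF x] by blast
  finally show ?thesis .
qed

lemma quot_algebra_assoc_algebra:
  assumes I: "ideal I A"
  shows "assoc_algebra K (quot_algebra A I)"
proof -
  interpret I: ideal I A by fact
  let ?Q = "quot_algebra A I"
  have carr: "\<exists>x\<in>carrier A. U = I +>\<^bsub>A\<^esub> x" if "U \<in> carrier ?Q" for U
    using that by (auto simp: FactRing_def A_RCOSETS_def')
  have coset: "I +>\<^bsub>A\<^esub> x \<in> carrier ?Q" if "x \<in> carrier A" for x
    using that by (auto simp: FactRing_def A_RCOSETS_def')
  have add: "(I +>\<^bsub>A\<^esub> x) \<oplus>\<^bsub>?Q\<^esub> (I +>\<^bsub>A\<^esub> y) = I +>\<^bsub>A\<^esub> (x \<oplus>\<^bsub>A\<^esub> y)"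
    if "x \<in> carrier A" "y \<in> carrier A" for x y
    using that by (simp add: FactRing_def I.a_rcos_sum)
  have mult: "(I +>\<^bsub>A\<^esub> x) \<otimes>\<^bsub>?Q\<^esub> (I +>\<^bsub>A\<^esub> y) = I +>\<^bsub>A\<^esub> (x \<otimes>\<^bsub>A\<^esub> y)"
    if "x \<in> carrier A" "y \<in> carrier A" for x y
    using that by (simp add: FactRing_def I.rcoset_mult_add)
  note smult = quot_smult_coset[OF I]
  interpret Q: ring "A Quot I" by (rule I.quotient_is_ring)
  have ring_Q: "ring ?Q"
  proof (rule ring.intro)
    show "abelian_group ?Q"
    proof (rule abelian_groupI)
      fix U assume "U \<in> carrier ?Q"
      then have "\<ominus>\<^bsub>A Quot I\<^esub> U \<in> carrier ?Q"
        and "(\<ominus>\<^bsub>A Quot I\<^esub> U) \<oplus>\<^bsub>?Q\<^esub> U = \<zero>\<^bsub>?Q\<^esub>"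
        by (simp_all add: Q.l_neg)
      then show "\<exists>V\<in>carrier ?Q. V \<oplus>\<^bsub>?Q\<^esub> U = \<zero>\<^bsub>?Q\<^esub>" by blast
    qed (simp_all add: Q.a_ac)
    show "Group.monoid ?Q"
      by (rule monoidI) (simp_all add: Q.m_assoc)
    show "ring_axioms ?Q"
      by (rule ring_axioms.intro) (simp_all add: Q.l_distr Q.r_distr)
  qed
  interpret R': ring ?Q by (rule ring_Q)
  show ?thesis
  proof (intro assoc_algebra.intro assoc_algebra_axioms.intro module.intro module_axioms.intro)
    show "field K" by (rule field_axioms)
    show "cring K" by (rule is_cring)
    show "ring ?Q" "abelian_group ?Q" by unfold_locales
  next
    fix a U assume "a \<in> carrier K" "U \<in> carrier ?Q"
    then show "a \<odot>\<^bsub>?Q\<^esub> U \<in> carrier ?Q"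
      using carr[of U] coset
      by (auto simp: smult simp del: quot_algebra_simps)
  next
    fix a b U assume "a \<in> carrier K" "b \<in> carrier K" "U \<in> carrier ?Q"
    then show "(a \<oplus> b) \<odot>\<^bsub>?Q\<^esub> U = a \<odot>\<^bsub>?Q\<^esub> U \<oplus>\<^bsub>?Q\<^esub> b \<odot>\<^bsub>?Q\<^esub> U"
      using carr[of U]
      by (auto simp: smult add smult_l_distr simp del: quot_algebra_simps)
  next
    fix a U V assume "a \<in> carrier K" "U \<in> carrier ?Q" "V \<in> carrier ?Q"
    then show "a \<odot>\<^bsub>?Q\<^esub> (U \<oplus>\<^bsub>?Q\<^esub> V) = a \<odot>\<^bsub>?Q\<^esub> U \<oplus>\<^bsub>?Q\<^esub> a \<odot>\<^bsub>?Q\<^esub> V"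
      using carr[of U] carr[of V]
      by (auto simp: smult add smult_r_distr simp del: quot_algebra_simps)
  next
    fix a b U assume "a \<in> carrier K" "b \<in> carrier K" "U \<in> carrier ?Q"
    then show "(a \<otimes> b) \<odot>\<^bsub>?Q\<^esub> U = a \<odot>\<^bsub>?Q\<^esub> (b \<odot>\<^bsub>?Q\<^esub> U)"
      using carr[of U]
      by (auto simp: smult smult_assoc1 simp del: quot_algebra_simps)
  next
    fix U assume "U \<in> carrier ?Q"
    then show "\<one> \<odot>\<^bsub>?Q\<^esub> U = U"
      using carr[of U] by (auto simp: smult simp del: quot_algebra_simps)
  next
    fix a U V assume "a \<in> carrier K" "U \<in> carrier ?Q" "V \<in> carrier ?Q"
    then show "(a \<odot>\<^bsub>?Q\<^esub> U) \<otimes>\<^bsub>?Q\<^esub> V = a \<odot>\<^bsub>?Q\<^esub> (U \<otimes>\<^bsub>?Q\<^esub> V)"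
      using carr[of U] carr[of V]
      by (auto simp: smult mult smult_mult_left simp del: quot_algebra_simps)
  next
    fix a U V assume "a \<in> carrier K" "U \<in> carrier ?Q" "V \<in> carrier ?Q"
    then show "U \<otimes>\<^bsub>?Q\<^esub> (a \<odot>\<^bsub>?Q\<^esub> V) = a \<odot>\<^bsub>?Q\<^esub> (U \<otimes>\<^bsub>?Q\<^esub> V)"
      using carr[of U] carr[of V]
      by (auto simp: smult mult smult_mult_right simp del: quot_algebra_simps)
  qed
qed

end

end

theory Submission
  imports Defs
begin

text \<open>
  For distinct words \<open>w\<^sub>1, \<dots>, w\<^sub>n\<close> let \<open>D\<close> be the alternating sum over permutations \<open>\<pi>\<close> of the
  products \<open>w\<^bsub>\<pi>(1)\<^esub>(x\<^sub>1) \<cdots> w\<^bsub>\<pi>(n)\<^esub>(x\<^sub>n)\<close> in disjoint blocks \<open>x\<^sub>j\<close> of variables. It is nonzero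
  with coefficients \<open>\<plusminus>1\<close>, and, being a determinant with linearly dependent rows, it vanishes on every
  algebra that satisfies some nonzero identity supported on \<open>w\<^sub>1, \<dots>, w\<^sub>n\<close>. So countably many
  identities suffice to catch all quotients \<open>R/P\<close> by nonzero primes. If infinitely many height one
  primes \<open>P\<close> shared one \<open>D\<close>, the chain condition would give an infinite subfamily with prime
  intersection \<open>I\<close>. As \<open>0\<close> is prime and \<open>I\<close> is strictly below some height one prime, \<open>I = 0\<close>;
  but then \<open>D\<close> is an identity of \<open>R\<close>.
\<close>

section \<open>Iterated sums in commutative monoids\<close>

context abelian_monoid
begin

lemma finsum_cartesian_product:
  assumes "finite I" "finite J" "\<And>i j. i \<in> I \<Longrightarrow> j \<in> J \<Longrightarrow> f i j \<in> carrier G"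
  shows "(\<Oplus>p\<in>I \<times> J. f (fst p) (snd p)) = (\<Oplus>i\<in>I. \<Oplus>j\<in>J. f i j)"
  using assms(1,3)
proof (induction I rule: finite_induct)
  case empty
  then show ?case by simp
next
  case (insert a I)
  have split: "insert a I \<times> J = Pair a ` J \<union> I \<times> J" by auto
  have "(\<Oplus>p\<in>insert a I \<times> J. f (fst p) (snd p)) =
      (\<Oplus>p\<in>Pair a ` J. f (fst p) (snd p)) \<oplus> (\<Oplus>p\<in>I \<times> J. f (fst p) (snd p))"
    unfolding split using insert assms(2) by (intro finsum_Un_disjoint) auto
  also have "(\<Oplus>p\<in>Pair a ` J. f (fst p) (snd p)) = (\<Oplus>j\<in>J. f a j)"
    using insert by (subst finsum_reindex) (auto simp: inj_on_def)
  also have "(\<Oplus>p\<in>I \<times> J. f (fst p) (snd p)) = (\<Oplus>i\<in>I. \<Oplus>j\<in>J. f i j)"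
    using insert by simp
  finally show ?case
    using insert by (simp add: Pi_def)
qed

text \<open>Both iterated sums equal a sum over pairs, and \<open>prod.swap\<close> reindexes one
  set of pairs into the other.\<close>

lemma finsum_swap:
  assumes "finite I" "finite J" "\<And>i j. i \<in> I \<Longrightarrow> j \<in> J \<Longrightarrow> f i j \<in> carrier G"
  shows "(\<Oplus>i\<in>I. \<Oplus>j\<in>J. f i j) = (\<Oplus>j\<in>J. \<Oplus>i\<in>I. f i j)"
proof -
  have "(\<Oplus>i\<in>I. \<Oplus>j\<in>J. f i j) = (\<Oplus>p\<in>prod.swap ` (J \<times> I). f (fst p) (snd p))"
    using finsum_cartesian_product[of I J f] assms by (simp add: product_swap)
  also have "\<dots> = (\<Oplus>p\<in>J \<times> I. f (snd p) (fst p))"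
    using assms by (subst finsum_reindex) (auto simp: product_swap)
  also have "\<dots> = (\<Oplus>j\<in>J. \<Oplus>i\<in>I. f i j)"
    using finsum_cartesian_product[of J I "\<lambda>j i. f i j"] assms by simp
  finally show ?thesis .
qed

end

section \<open>Words in disjoint blocks of variables and the generic determinant\<close>

lemma word_eval_map: "word_eval A s (map g w) = word_eval A (s \<circ> g) w"
  by (induction w) (simp_all add: word_eval_def)

text \<open>If \<open>b\<close> tells from which list an entry comes, filtering by \<open>b\<close>
  undoes the concatenation. With \<open>b\<close> the block number of a variable, this reads single
  factors off a long monomial.\<close>

lemma filter_concat_blocks:
  assumes "\<And>l x. l < n \<Longrightarrow> x \<in> set (F l) \<Longrightarrow> b x = l"
  shows "filter (\<lambda>x. b x = j) (concat (map F [0..<n])) = (if j < n then F j else [])"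
  using assms
proof (induction n)
  case 0
  then show ?case by simp
next
  case (Suc n)
  have "filter (\<lambda>x. b x = j) (F n) = (if j = n then F n else [])"
    using Suc.prems[of n] by (auto simp: filter_empty_conv intro!: filter_True)
  then show ?case using Suc by auto
qed

text \<open>The sum of \<open>c t\<close> times the monomial \<open>m t\<close>. Like terms are not
  collected, so this reading is correct only when \<open>m\<close> is injective on \<open>T\<close>;
  each use supplies that injectivity.\<close>

definition family_poly ::
  "('k, 'n) ring_scheme \<Rightarrow> 't set \<Rightarrow> ('t \<Rightarrow> nat list) \<Rightarrow> ('t \<Rightarrow> 'k) \<Rightarrow> nat list \<Rightarrow> 'k"
  where "family_poly K T m c w = (if w \<in> m ` T then c (the_inv_into T m w) else \<zero>\<^bsub>K\<^esub>)"

text \<open>Variables are split into disjoint blocks; \<open>prod_encode (j, l)\<close> is the copy of the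
  variable \<open>l\<close> in block \<open>j\<close>.\<close>

abbreviation block_word :: "nat \<Rightarrow> nat list \<Rightarrow> nat list"
  where "block_word j \<equiv> map (\<lambda>l. prod_encode (j, l))"

abbreviation block_subst :: "(nat \<Rightarrow> 'a) \<Rightarrow> nat \<Rightarrow> nat \<Rightarrow> 'a"
  where "block_subst s j l \<equiv> s (prod_encode (j, l))"

lemma filter_block_word:
  "filter (\<lambda>x. fst (prod_decode x) = j) (block_word i w) = (if i = j then block_word i w else [])"
  by (auto simp: filter_empty_conv intro!: filter_True)

lemma block_word_inject: "block_word j u = block_word j v \<longleftrightarrow> u = v"
  by (rule inj_eq) (auto simp: inj_map_eq_map inj_def)

abbreviation perm_sign :: "('k, 'n) ring_scheme \<Rightarrow> (nat \<Rightarrow> nat) \<Rightarrow> 'k"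
  where "perm_sign K \<pi> \<equiv> if evenperm \<pi> then \<one>\<^bsub>K\<^esub> else \<ominus>\<^bsub>K\<^esub> \<one>\<^bsub>K\<^esub>"

definition perm_word :: "nat list list \<Rightarrow> (nat \<Rightarrow> nat) \<Rightarrow> nat list"
  where "perm_word ws \<pi> = concat (map (\<lambda>j. block_word j (ws ! \<pi> j)) [0..<length ws])"

text \<open>The letters of block \<open>j\<close> spell a copy of \<open>ws ! \<pi> j\<close>, and
  distinctness of \<open>ws\<close> then gives \<open>\<pi> j\<close>. Hence no two terms of the
  determinant share a monomial, and nothing can cancel.\<close>

lemma inj_on_perm_word:
  assumes "distinct ws"
  shows "inj_on (perm_word ws) {\<pi>. \<pi> permutes {..<length ws}}"
proof (rule inj_onI)
  fix \<pi> \<sigma> assume p: "\<pi> \<in> {\<pi>. \<pi> permutes {..<length ws}}" "\<sigma> \<in> {\<pi>. \<pi> permutes {..<length ws}}"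
    and eq: "perm_word ws \<pi> = perm_word ws \<sigma>"
  have block: "filter (\<lambda>x. fst (prod_decode x) = j) (perm_word ws \<rho>) = block_word j (ws ! \<rho> j)"
    if "j < length ws" for j \<rho>
    unfolding perm_word_def using that
    by (subst filter_concat_blocks[where b = "\<lambda>x. fst (prod_decode x)"]) auto
  show "\<pi> = \<sigma>"
  proof
    fix j
    show "\<pi> j = \<sigma> j"
    proof (cases "j < length ws")
      case True
      then have "ws ! \<pi> j = ws ! \<sigma> j"
        using block[of j \<pi>] block[of j \<sigma>] eq by (simp only: block_word_inject)
      moreover have "\<pi> j < length ws" "\<sigma> j < length ws"
        using p True permutes_in_image by fastforce+
      ultimately show ?thesis using assms by (simp add: nth_eq_iff_index_eq)
    next
      case False
      then show ?thesis using p by (simp add: permutes_def)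
    qed
  qed
qed

text \<open>The generic determinant of the words \<open>ws\<close>: row \<open>i\<close> belongs to the word \<open>ws ! i\<close>, column
  \<open>j\<close> to the \<open>j\<close>-th block of variables, and factors are multiplied in the order of the columns.\<close>

definition det_poly :: "('k, 'n) ring_scheme \<Rightarrow> nat list list \<Rightarrow> nat list \<Rightarrow> 'k"
  where "det_poly K ws =
    family_poly K {\<pi>. \<pi> permutes {..<length ws}} (perm_word ws) (perm_sign K)"

section \<open>Ordered products and the vanishing of determinants with dependent rows\<close>

lemma foldr_mult_append:
  fixes A (structure)
  assumes "Group.monoid A" "set xs \<subseteq> carrier A" "set ys \<subseteq> carrier A"
  shows "foldr (\<otimes>) (xs @ ys) \<one> = foldr (\<otimes>) xs \<one> \<otimes> foldr (\<otimes>) ys \<one>"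
    and "foldr (\<otimes>) xs \<one> \<in> carrier A"
proof -
  interpret Group.monoid A by fact
  have closed: "foldr (\<otimes>) zs \<one> \<in> carrier A" if "set zs \<subseteq> carrier A" for zs
    using that by (induction zs) auto
  show "foldr (\<otimes>) xs \<one> \<in> carrier A"
    using closed assms(2) .
  show "foldr (\<otimes>) (xs @ ys) \<one> = foldr (\<otimes>) xs \<one> \<otimes> foldr (\<otimes>) ys \<one>"
    using assms(2) closed[OF assms(3)] by (induction xs) (auto simp: closed m_assoc)
qed

context assoc_algebra
begin

text \<open>Composing with a transposition exchanges even and odd permutations and preserves
  \<open>h\<close>, so the odd half of the sum is the negative of the even half. This works in every
  characteristic, including 2.\<close>

lemma finsum_alternating:
  assumes ik: "i < n" "k < n" "i \<noteq> k"
    and h: "\<And>\<pi>. \<pi> permutes {..<n} \<Longrightarrow> h \<pi> \<in> carrier A"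
    and inv: "\<And>\<pi>. \<pi> permutes {..<n} \<Longrightarrow> h (transpose i k \<circ> \<pi>) = h \<pi>"
  shows "(\<Oplus>\<^bsub>A\<^esub>\<pi>\<in>{\<pi>. \<pi> permutes {..<n}}. perm_sign K \<pi> \<odot>\<^bsub>A\<^esub> h \<pi>) = \<zero>\<^bsub>A\<^esub>"
proof -
  define E where "E = {\<pi>. \<pi> permutes {..<n} \<and> evenperm \<pi>}"
  define T where "T = {\<pi>. \<pi> permutes {..<n}}"
  define t where "t = (\<lambda>\<pi>. transpose i k \<circ> \<pi> :: nat \<Rightarrow> nat)"
  have fin: "finite T" unfolding T_def by (rule finite_permutations) simp
  have tp: "transpose i k permutes {..<n}"
    using ik by (intro permutes_swap_id) auto
  have tT: "t \<pi> \<in> T" if "\<pi> \<in> T" for \<pi>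
    using that tp by (auto simp: T_def t_def intro: permutes_compose)
  have tt: "t (t \<pi>) = \<pi>" for \<pi>
    by (auto simp: t_def fun_eq_iff)
  have ev: "evenperm (t \<pi>) \<longleftrightarrow> \<not> evenperm \<pi>" if "\<pi> \<in> T" for \<pi>
  proof -
    have "permutation \<pi>" "permutation (transpose i k)"
      using that tp by (auto simp: T_def permutation_permutes)
    then show ?thesis using ik by (simp add: t_def evenperm_comp evenperm_swap)
  qed
  have ET: "E \<subseteq> T" "E = {\<pi> \<in> T. evenperm \<pi>}" by (auto simp: E_def T_def)
  have inj: "inj_on t E" by (metis inj_onI tt)
  have im: "T = E \<union> t ` E" "E \<inter> t ` E = {}"
  proof -
    have "\<pi> \<in> t ` E" if "\<pi> \<in> T" "\<pi> \<notin> E" for \<pi>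
      using that tT[OF that(1)] ev[OF that(1)] tt[of \<pi>] unfolding ET(2) by (metis (no_types, lifting) image_eqI mem_Collect_eq)
    then show "T = E \<union> t ` E" using tT ET by blast
    show "E \<inter> t ` E = {}" using ev ET by auto
  qed
  have hT: "h \<pi> \<in> carrier A" if "\<pi> \<in> T" for \<pi> using h that by (simp add: T_def)
  have "(\<Oplus>\<^bsub>A\<^esub>\<pi>\<in>T. perm_sign K \<pi> \<odot>\<^bsub>A\<^esub> h \<pi>) =
      (\<Oplus>\<^bsub>A\<^esub>\<pi>\<in>E. perm_sign K \<pi> \<odot>\<^bsub>A\<^esub> h \<pi>) \<oplus>\<^bsub>A\<^esub> (\<Oplus>\<^bsub>A\<^esub>\<pi>\<in>t ` E. perm_sign K \<pi> \<odot>\<^bsub>A\<^esub> h \<pi>)"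
    using im fin hT tT ET(1) unfolding im(1)
    by (intro M.finsum_Un_disjoint) (auto intro: finite_subset)
  also have "(\<Oplus>\<^bsub>A\<^esub>\<pi>\<in>t ` E. perm_sign K \<pi> \<odot>\<^bsub>A\<^esub> h \<pi>) =
      (\<Oplus>\<^bsub>A\<^esub>\<pi>\<in>E. perm_sign K (t \<pi>) \<odot>\<^bsub>A\<^esub> h (t \<pi>))"
    using hT tT ET(1) by (intro M.finsum_reindex inj) auto
  also have "\<dots> = (\<Oplus>\<^bsub>A\<^esub>\<pi>\<in>E. (\<ominus>\<^bsub>K\<^esub> \<one>\<^bsub>K\<^esub>) \<odot>\<^bsub>A\<^esub> (perm_sign K \<pi> \<odot>\<^bsub>A\<^esub> h \<pi>))"
  proof (rule M.finsum_cong')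
    fix \<pi> assume \<pi>: "\<pi> \<in> E"
    then have "h (t \<pi>) = h \<pi>" using inv by (simp add: t_def E_def)
    then show "perm_sign K (t \<pi>) \<odot>\<^bsub>A\<^esub> h (t \<pi>) = (\<ominus>\<^bsub>K\<^esub> \<one>\<^bsub>K\<^esub>) \<odot>\<^bsub>A\<^esub> (perm_sign K \<pi> \<odot>\<^bsub>A\<^esub> h \<pi>)"
      using \<pi> ev[of \<pi>] hT[of \<pi>] ET by (auto simp: smult_one)
  qed (use hT ET in auto)
  also have "\<dots> = (\<ominus>\<^bsub>K\<^esub> \<one>\<^bsub>K\<^esub>) \<odot>\<^bsub>A\<^esub> (\<Oplus>\<^bsub>A\<^esub>\<pi>\<in>E. perm_sign K \<pi> \<odot>\<^bsub>A\<^esub> h \<pi>)"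
    using hT ET fin by (intro finsum_smult_ldistr[symmetric]) (auto intro: finite_subset)
  finally have "(\<Oplus>\<^bsub>A\<^esub>\<pi>\<in>T. perm_sign K \<pi> \<odot>\<^bsub>A\<^esub> h \<pi>) =
    (\<Oplus>\<^bsub>A\<^esub>\<pi>\<in>E. perm_sign K \<pi> \<odot>\<^bsub>A\<^esub> h \<pi>) \<oplus>\<^bsub>A\<^esub> \<ominus>\<^bsub>A\<^esub> (\<Oplus>\<^bsub>A\<^esub>\<pi>\<in>E. perm_sign K \<pi> \<odot>\<^bsub>A\<^esub> h \<pi>)"
    using hT ET by (subst (asm) smult_l_minus) (auto simp: smult_one Pi_def)
  also have "\<dots> = \<zero>\<^bsub>A\<^esub>"
    using hT ET by (intro M.r_neg M.finsum_closed) auto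
  finally show ?thesis unfolding T_def .
qed

text \<open>Column \<open>j\<close> contributes its entry in row \<open>g j\<close>. The choice
  \<open>g\<close> may be any function, because replacing the row used in one column of a
  permutation can repeat a row.\<close>

definition row_prod :: "nat \<Rightarrow> (nat \<Rightarrow> nat \<Rightarrow> 'c) \<Rightarrow> (nat \<Rightarrow> nat) \<Rightarrow> 'c"
  where "row_prod n M g = foldr (\<otimes>\<^bsub>A\<^esub>) (map (\<lambda>j. M (g j) j) [0..<n]) \<one>\<^bsub>A\<^esub>"

lemma row_prod_closed:
  assumes "\<And>j. j < n \<Longrightarrow> M (g j) j \<in> carrier A"
  shows "row_prod n M g \<in> carrier A"
  unfolding row_prod_def using assms
  by (intro foldr_mult_append(2)[where ys = "[]"]) (auto simp: A.monoid_axioms)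

text \<open>The factors left and right of column \<open>j\<close> multiply to \<open>L\<close> and
  \<open>U\<close>, the same for all \<open>i\<close>. By bilinearity the sum is \<open>L\<close>
  times the relation in column \<open>j\<close> times \<open>U\<close>.\<close>

lemma row_prod_upd_relation:
  assumes a: "\<And>i. i < n \<Longrightarrow> a i \<in> carrier K"
    and M: "\<And>i j. i < n \<Longrightarrow> j < n \<Longrightarrow> M i j \<in> carrier A"
    and j: "j < n" and g: "\<And>l. l < n \<Longrightarrow> g l < n"
    and rel: "(\<Oplus>\<^bsub>A\<^esub>i\<in>{..<n}. a i \<odot>\<^bsub>A\<^esub> M i j) = \<zero>\<^bsub>A\<^esub>"
  shows "(\<Oplus>\<^bsub>A\<^esub>i\<in>{..<n}. a i \<odot>\<^bsub>A\<^esub> row_prod n M (g(j := i))) = \<zero>\<^bsub>A\<^esub>"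
proof -
  define L where "L = foldr (\<otimes>\<^bsub>A\<^esub>) (map (\<lambda>l. M (g l) l) [0..<j]) \<one>\<^bsub>A\<^esub>"
  define U where "U = foldr (\<otimes>\<^bsub>A\<^esub>) (map (\<lambda>l. M (g l) l) [Suc j..<n]) \<one>\<^bsub>A\<^esub>"
  have L: "L \<in> carrier A" and U: "U \<in> carrier A" unfolding L_def U_def
    using M g j by (auto intro!: foldr_mult_append(2)[where ys = "[]"] simp: A.monoid_axioms)
  have upt: "[0..<n] = [0..<j] @ j # [Suc j..<n]"
    using j by (metis le_add_diff_inverse less_imp_le upt_add_eq_append upt_conv_Cons zero_le)
  have eq: "row_prod n M (g(j := i)) = L \<otimes>\<^bsub>A\<^esub> (M i j \<otimes>\<^bsub>A\<^esub> U)" if i: "i < n" for i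
  proof -
    have "row_prod n M (g(j := i)) =
        foldr (\<otimes>\<^bsub>A\<^esub>) (map (\<lambda>l. M (g l) l) [0..<j] @ M i j # map (\<lambda>l. M (g l) l) [Suc j..<n]) \<one>\<^bsub>A\<^esub>"
      unfolding row_prod_def upt by (auto intro!: arg_cong2[where f = "\<lambda>xs ys. foldr _ xs (_ (foldr _ ys _))"])
    also have "\<dots> = L \<otimes>\<^bsub>A\<^esub> foldr (\<otimes>\<^bsub>A\<^esub>) (M i j # map (\<lambda>l. M (g l) l) [Suc j..<n]) \<one>\<^bsub>A\<^esub>"
      unfolding L_def using M g j i
      by (intro foldr_mult_append(1)) (auto simp: A.monoid_axioms)
    finally show ?thesis by (simp add: U_def)
  qed
  have "(\<Oplus>\<^bsub>A\<^esub>i\<in>{..<n}. a i \<odot>\<^bsub>A\<^esub> row_prod n M (g(j := i))) =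
      (\<Oplus>\<^bsub>A\<^esub>i\<in>{..<n}. L \<otimes>\<^bsub>A\<^esub> ((a i \<odot>\<^bsub>A\<^esub> M i j) \<otimes>\<^bsub>A\<^esub> U))"
    using a M j L U by (intro M.finsum_cong') (auto simp: eq smult_mult_left smult_mult_right)
  also have "\<dots> = L \<otimes>\<^bsub>A\<^esub> ((\<Oplus>\<^bsub>A\<^esub>i\<in>{..<n}. a i \<odot>\<^bsub>A\<^esub> M i j) \<otimes>\<^bsub>A\<^esub> U)"
    using a M j L U by (subst A.finsum_ldistr) (auto intro!: A.finsum_rdistr[symmetric])
  finally show ?thesis using rel L U by simp
qed

text \<open>Expanding \<open>a\<^sub>k\<close> times the factor from row \<open>k\<close> by the relation turns row \<open>k\<close> into the other
  rows; the resulting sums have two equal rows, hence vanish. Only products in a fixed column order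
  occur, so commutativity is not needed.\<close>

lemma det_dependent_rows:
  assumes a: "\<And>i. i < n \<Longrightarrow> a i \<in> carrier K" and k: "k < n" "a k \<noteq> \<zero>\<^bsub>K\<^esub>"
    and M: "\<And>i j. i < n \<Longrightarrow> j < n \<Longrightarrow> M i j \<in> carrier A"
    and rel: "\<And>j. j < n \<Longrightarrow> (\<Oplus>\<^bsub>A\<^esub>i\<in>{..<n}. a i \<odot>\<^bsub>A\<^esub> M i j) = \<zero>\<^bsub>A\<^esub>"
  shows "(\<Oplus>\<^bsub>A\<^esub>\<pi>\<in>{\<pi>. \<pi> permutes {..<n}}. perm_sign K \<pi> \<odot>\<^bsub>A\<^esub> row_prod n M \<pi>) = \<zero>\<^bsub>A\<^esub>"
    (is "?D = _")
proof -
  define T where "T = {\<pi>. \<pi> permutes {..<n}}"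
  \<comment> \<open>\<open>inv_into UNIV \<pi> k\<close> is the column in which \<open>\<pi>\<close>
    uses row \<open>k\<close>; \<open>h i \<pi>\<close> uses row \<open>i\<close> there
    instead.\<close>
  define h where "h = (\<lambda>i \<pi>. row_prod n M (\<pi>(inv_into UNIV \<pi> k := i)))"
  have fin: "finite T" unfolding T_def by (rule finite_permutations) simp
  have less: "\<pi> j < n" "inv_into UNIV \<pi> j < n" if "\<pi> permutes {..<n}" "j < n" for \<pi> j
    using that by (metis lessThan_iff permutes_in_image, metis lessThan_iff permutes_in_image permutes_inv)
  have h: "h i \<pi> \<in> carrier A" if "\<pi> \<in> T" "i < n" for i \<pi>
    unfolding h_def using that k M less by (intro row_prod_closed) (auto simp: T_def)
  have hk: "h k \<pi> = row_prod n M \<pi>" if "\<pi> \<in> T" for \<pi>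
  proof -
    have "\<pi>(inv_into UNIV \<pi> k := k) = \<pi>"
      using that by (metis T_def fun_upd_triv mem_Collect_eq permutes_inverses(1))
    then show ?thesis by (simp add: h_def)
  qed
  have alt: "(\<Oplus>\<^bsub>A\<^esub>\<pi>\<in>T. perm_sign K \<pi> \<odot>\<^bsub>A\<^esub> h i \<pi>) = \<zero>\<^bsub>A\<^esub>" if i: "i < n" "i \<noteq> k" for i
    unfolding T_def
  proof (rule finsum_alternating[OF i(1) k(1) i(2)])
    fix \<pi> assume \<pi>: "\<pi> permutes {..<n}"
    show "h i \<pi> \<in> carrier A" using h \<pi> i by (simp add: T_def)
    have bij: "bij \<pi>" using \<pi> by (rule permutes_bij)
    have inv: "inv_into UNIV (transpose i k \<circ> \<pi>) k = inv_into UNIV \<pi> i"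
      using bij by (subst o_inv_distrib) auto
    \<comment> \<open>On both sides row \<open>i\<close> is used twice, in the columns where
      \<open>\<pi>\<close> takes the values \<open>i\<close> and \<open>k\<close>; all other columns
      agree.\<close>
    have "(transpose i k \<circ> \<pi>)(inv_into UNIV \<pi> i := i) = \<pi>(inv_into UNIV \<pi> k := i)"
      using \<pi> i(2) by (auto simp: fun_eq_iff transpose_def permutes_inverses permutes_inv_eq)
    then show "h i (transpose i k \<circ> \<pi>) = h i \<pi>"
      by (simp add: h_def inv)
  qed
  \<comment> \<open>Each inner sum is the row relation in the column where \<open>\<pi>\<close> uses
    row \<open>k\<close>, surrounded by the other factors. Exchanging the two sums will turn this
    into a statement about each row \<open>i\<close>.\<close>
  have "\<zero>\<^bsub>A\<^esub> = (\<Oplus>\<^bsub>A\<^esub>\<pi>\<in>T. perm_sign K \<pi> \<odot>\<^bsub>A\<^esub> (\<Oplus>\<^bsub>A\<^esub>i\<in>{..<n}. a i \<odot>\<^bsub>A\<^esub> h i \<pi>))"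
  proof (rule M.add.finprod_one_eqI[symmetric, simplified])
    fix \<pi> assume "\<pi> \<in> T"
    then have \<pi>: "\<pi> permutes {..<n}" by (simp add: T_def)
    have "(\<Oplus>\<^bsub>A\<^esub>i\<in>{..<n}. a i \<odot>\<^bsub>A\<^esub> h i \<pi>) = \<zero>\<^bsub>A\<^esub>"
      unfolding h_def using less[OF \<pi>] k
      by (intro row_prod_upd_relation a M rel) auto
    then show "perm_sign K \<pi> \<odot>\<^bsub>A\<^esub> (\<Oplus>\<^bsub>A\<^esub>i\<in>{..<n}. a i \<odot>\<^bsub>A\<^esub> h i \<pi>) = \<zero>\<^bsub>A\<^esub>"
      by simp
  qed
  also have "\<dots> = (\<Oplus>\<^bsub>A\<^esub>\<pi>\<in>T. \<Oplus>\<^bsub>A\<^esub>i\<in>{..<n}. perm_sign K \<pi> \<odot>\<^bsub>A\<^esub> (a i \<odot>\<^bsub>A\<^esub> h i \<pi>))"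
    using h a by (intro M.finsum_cong' finsum_smult_ldistr) auto
  also have "\<dots> = (\<Oplus>\<^bsub>A\<^esub>i\<in>{..<n}. \<Oplus>\<^bsub>A\<^esub>\<pi>\<in>T. perm_sign K \<pi> \<odot>\<^bsub>A\<^esub> (a i \<odot>\<^bsub>A\<^esub> h i \<pi>))"
    using h a fin by (intro M.finsum_swap) auto
  also have "\<dots> = (\<Oplus>\<^bsub>A\<^esub>i\<in>{..<n}. a i \<odot>\<^bsub>A\<^esub> (\<Oplus>\<^bsub>A\<^esub>\<pi>\<in>T. perm_sign K \<pi> \<odot>\<^bsub>A\<^esub> h i \<pi>))"
  proof (rule M.finsum_cong')
    fix i assume "i \<in> {..<n}"
    then have "a i \<odot>\<^bsub>A\<^esub> (\<Oplus>\<^bsub>A\<^esub>\<pi>\<in>T. perm_sign K \<pi> \<odot>\<^bsub>A\<^esub> h i \<pi>) =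
        (\<Oplus>\<^bsub>A\<^esub>\<pi>\<in>T. a i \<odot>\<^bsub>A\<^esub> (perm_sign K \<pi> \<odot>\<^bsub>A\<^esub> h i \<pi>))"
      using h a fin by (intro finsum_smult_ldistr) auto
    also have "\<dots> = (\<Oplus>\<^bsub>A\<^esub>\<pi>\<in>T. perm_sign K \<pi> \<odot>\<^bsub>A\<^esub> (a i \<odot>\<^bsub>A\<^esub> h i \<pi>))"
      using h a \<open>i \<in> {..<n}\<close> by (intro M.finsum_cong') (auto simp flip: smult_assoc1 simp: m_comm)
    finally show "(\<Oplus>\<^bsub>A\<^esub>\<pi>\<in>T. perm_sign K \<pi> \<odot>\<^bsub>A\<^esub> (a i \<odot>\<^bsub>A\<^esub> h i \<pi>)) =
        a i \<odot>\<^bsub>A\<^esub> (\<Oplus>\<^bsub>A\<^esub>\<pi>\<in>T. perm_sign K \<pi> \<odot>\<^bsub>A\<^esub> h i \<pi>)" by simp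
  qed (use h a in auto)
  \<comment> \<open>By \<open>alt\<close> only the summand \<open>i = k\<close> survives. It is
    \<open>a k\<close> times the determinant, and \<open>a k\<close> is invertible in the
    field.\<close>
  also have "\<dots> = (\<Oplus>\<^bsub>A\<^esub>i\<in>{..<n}. if k = i then a i \<odot>\<^bsub>A\<^esub> (\<Oplus>\<^bsub>A\<^esub>\<pi>\<in>T. perm_sign K \<pi> \<odot>\<^bsub>A\<^esub> h i \<pi>) else \<zero>\<^bsub>A\<^esub>)"
    using h a alt by (intro M.finsum_cong') auto
  also have "\<dots> = a k \<odot>\<^bsub>A\<^esub> (\<Oplus>\<^bsub>A\<^esub>\<pi>\<in>T. perm_sign K \<pi> \<odot>\<^bsub>A\<^esub> h k \<pi>)"
    using h a k by (intro M.finsum_singleton) auto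
  also have "(\<Oplus>\<^bsub>A\<^esub>\<pi>\<in>T. perm_sign K \<pi> \<odot>\<^bsub>A\<^esub> h k \<pi>) = ?D"
    unfolding T_def[symmetric] using h k hk by (intro M.finsum_cong') (auto simp flip: hk)
  finally have 0: "a k \<odot>\<^bsub>A\<^esub> ?D = \<zero>\<^bsub>A\<^esub>" by simp
  have D: "?D \<in> carrier A"
    unfolding T_def[symmetric] using h k by (intro M.finsum_closed) (auto simp flip: hk)
  have u: "a k \<in> Units K" using a k field_Units by auto
  have "?D = (inv\<^bsub>K\<^esub> a k \<otimes>\<^bsub>K\<^esub> a k) \<odot>\<^bsub>A\<^esub> ?D"
    using u D by (simp add: smult_one)
  also have "\<dots> = \<zero>\<^bsub>A\<^esub>"
    using u D by (subst smult_assoc1) (auto simp: 0)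
  finally show ?thesis .
qed


section \<open>Evaluation of words and noncommutative polynomials\<close>

lemma word_eval_closed:
  assumes "range s \<subseteq> carrier A"
  shows "word_eval A s w \<in> carrier A"
  using assms by (induction w) (auto simp: word_eval_def)

lemma word_eval_append:
  assumes "range s \<subseteq> carrier A"
  shows "word_eval A s (u @ v) = word_eval A s u \<otimes>\<^bsub>A\<^esub> word_eval A s v"
  using assms word_eval_closed[OF assms]
  by (induction u) (auto simp: word_eval_def A.m_assoc range_subsetD)

lemma word_eval_concat:
  assumes "range s \<subseteq> carrier A"
  shows "word_eval A s (concat ws) = foldr (\<otimes>\<^bsub>A\<^esub>) (map (word_eval A s) ws) \<one>\<^bsub>A\<^esub>"
  using assms by (induction ws) (simp_all add: word_eval_append, simp add: word_eval_def)

lemma nc_polys_coeff: "f \<in> nc_polys K \<Longrightarrow> f w \<in> carrier K"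
  and nc_polys_finite: "f \<in> nc_polys K \<Longrightarrow> finite {w. f w \<noteq> \<zero>\<^bsub>K\<^esub>}"
  by (simp_all add: nc_polys_def)

lemma nc_eval_closed:
  assumes "f \<in> nc_polys K" "range s \<subseteq> carrier A"
  shows "nc_eval K A s f \<in> carrier A"
  unfolding nc_eval_def using assms
  by (intro M.finsum_closed) (auto intro!: smult_closed nc_polys_coeff word_eval_closed)

lemma nc_eval_superset:
  assumes f: "f \<in> nc_polys K" and s: "range s \<subseteq> carrier A"
    and W: "finite W" "{w. f w \<noteq> \<zero>\<^bsub>K\<^esub>} \<subseteq> W"
  shows "nc_eval K A s f = (\<Oplus>\<^bsub>A\<^esub>w\<in>W. f w \<odot>\<^bsub>A\<^esub> word_eval A s w)"
  unfolding nc_eval_def using assms word_eval_closed[OF s] nc_polys_coeff[OF f]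
  by (intro M.add.finprod_mono_neutral_cong_left) auto

lemma family_poly_in_nc_polys:
  assumes "finite T" "inj_on m T" "\<And>t. t \<in> T \<Longrightarrow> c t \<in> carrier K"
  shows "family_poly K T m c \<in> nc_polys K"
proof -
  have "{w. family_poly K T m c w \<noteq> \<zero>\<^bsub>K\<^esub>} \<subseteq> m ` T"
    by (auto simp: family_poly_def)
  then have "finite {w. family_poly K T m c w \<noteq> \<zero>\<^bsub>K\<^esub>}"
    using assms(1) by (meson finite_imageI finite_subset)
  then show ?thesis
    using assms by (auto simp: nc_polys_def family_poly_def the_inv_into_f_f)
qed

lemma family_poly_nonzero:
  assumes "inj_on m T" "t \<in> T" "c t \<noteq> \<zero>\<^bsub>K\<^esub>"
  shows "family_poly K T m c \<noteq> (\<lambda>w. \<zero>\<^bsub>K\<^esub>)"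
proof
  assume "family_poly K T m c = (\<lambda>w. \<zero>\<^bsub>K\<^esub>)"
  then have "family_poly K T m c (m t) = \<zero>\<^bsub>K\<^esub>" by simp
  then show False using assms by (simp add: family_poly_def the_inv_into_f_f)
qed

lemma nc_eval_family_poly:
  assumes T: "finite T" "inj_on m T" "\<And>t. t \<in> T \<Longrightarrow> c t \<in> carrier K"
    and s: "range s \<subseteq> carrier A"
  shows "nc_eval K A s (family_poly K T m c) = (\<Oplus>\<^bsub>A\<^esub>t\<in>T. c t \<odot>\<^bsub>A\<^esub> word_eval A s (m t))"
proof -
  have "nc_eval K A s (family_poly K T m c) =
      (\<Oplus>\<^bsub>A\<^esub>w\<in>m ` T. family_poly K T m c w \<odot>\<^bsub>A\<^esub> word_eval A s w)"
    using T by (intro nc_eval_superset family_poly_in_nc_polys s) (auto simp: family_poly_def)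
  also have "\<dots> = (\<Oplus>\<^bsub>A\<^esub>t\<in>T. family_poly K T m c (m t) \<odot>\<^bsub>A\<^esub> word_eval A s (m t))"
    using T by (intro M.finsum_reindex)
      (auto intro!: smult_closed word_eval_closed[OF s] nc_polys_coeff[OF family_poly_in_nc_polys])
  also have "\<dots> = (\<Oplus>\<^bsub>A\<^esub>t\<in>T. c t \<odot>\<^bsub>A\<^esub> word_eval A s (m t))"
    using T word_eval_closed[OF s]
    by (intro M.finsum_cong') (auto simp: family_poly_def the_inv_into_f_f)
  finally show ?thesis .
qed

section \<open>Determinants and products as polynomial identities\<close>

lemma det_poly_in_nc_polys: "distinct ws \<Longrightarrow> det_poly K ws \<in> nc_polys K"
  unfolding det_poly_def
  by (rule family_poly_in_nc_polys) (auto intro: finite_permutations inj_on_perm_word)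

text \<open>The identity permutation has coefficient 1, and by injectivity of
  \<open>perm_word\<close> no other term shares its monomial.\<close>

lemma det_poly_nonzero: "distinct ws \<Longrightarrow> det_poly K ws \<noteq> (\<lambda>w. \<zero>\<^bsub>K\<^esub>)"
  unfolding det_poly_def
  by (rule family_poly_nonzero[where t = id]) (auto intro: inj_on_perm_word permutes_id)

lemma nc_eval_det_poly:
  assumes "distinct ws" and s: "range s \<subseteq> carrier A"
  shows "nc_eval K A s (det_poly K ws) =
    (\<Oplus>\<^bsub>A\<^esub>\<pi>\<in>{\<pi>. \<pi> permutes {..<length ws}}. perm_sign K \<pi> \<odot>\<^bsub>A\<^esub>
      row_prod (length ws) (\<lambda>i j. word_eval A (block_subst s j) (ws ! i)) \<pi>)"
proof -
  have "word_eval A s (perm_word ws \<pi>) =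
      row_prod (length ws) (\<lambda>i j. word_eval A (block_subst s j) (ws ! i)) \<pi>" for \<pi>
    unfolding perm_word_def row_prod_def word_eval_concat[OF s]
    by (simp add: comp_def word_eval_map)
  then show ?thesis
    using assms unfolding det_poly_def
    by (subst nc_eval_family_poly) (auto intro: finite_permutations inj_on_perm_word)
qed

text \<open>Evaluating \<open>f\<close> on the \<open>j\<close>-th block of variables gives a linear
  relation among the entries of column \<open>j\<close>. The coefficients \<open>f (ws ! i)\<close>
  are the same for all columns and not all zero, so the rows are dependent.\<close>

lemma det_poly_identity:
  assumes ws: "distinct ws" "{w. f w \<noteq> \<zero>\<^bsub>K\<^esub>} \<subseteq> set ws"
    and f: "f \<in> nc_polys K" "f \<noteq> (\<lambda>w. \<zero>\<^bsub>K\<^esub>)"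
    and ident: "\<And>s. range s \<subseteq> carrier A \<Longrightarrow> nc_eval K A s f = \<zero>\<^bsub>A\<^esub>"
    and s: "range s \<subseteq> carrier A"
  shows "nc_eval K A s (det_poly K ws) = \<zero>\<^bsub>A\<^esub>"
proof -
  obtain k where k: "k < length ws" "f (ws ! k) \<noteq> \<zero>\<^bsub>K\<^esub>"
  proof -
    obtain w where w: "f w \<noteq> \<zero>\<^bsub>K\<^esub>" using f(2) by auto
    then have "w \<in> set ws" using ws(2) by auto
    then show thesis using that w by (auto simp: in_set_conv_nth)
  qed
  have sj: "range (block_subst s j) \<subseteq> carrier A" for j using s by auto
  have rel: "(\<Oplus>\<^bsub>A\<^esub>i\<in>{..<length ws}. f (ws ! i) \<odot>\<^bsub>A\<^esub> word_eval A (block_subst s j) (ws ! i)) = \<zero>\<^bsub>A\<^esub>"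
    for j
  proof -
    have bij: "inj_on ((!) ws) {..<length ws}" "(!) ws ` {..<length ws} = set ws"
      using bij_betw_nth[OF ws(1) refl refl] by (auto simp: bij_betw_def)
    have "(\<Oplus>\<^bsub>A\<^esub>i\<in>{..<length ws}. f (ws ! i) \<odot>\<^bsub>A\<^esub> word_eval A (block_subst s j) (ws ! i)) =
        (\<Oplus>\<^bsub>A\<^esub>w\<in>(!) ws ` {..<length ws}. f w \<odot>\<^bsub>A\<^esub> word_eval A (block_subst s j) w)"
      using bij word_eval_closed[OF sj] nc_polys_coeff[OF f(1)]
      by (intro M.finsum_reindex[symmetric]) auto
    also have "\<dots> = nc_eval K A (block_subst s j) f"
      unfolding bij(2) using ws(2) by (intro nc_eval_superset[symmetric] f sj) auto
    finally show ?thesis using ident[OF sj] by simp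
  qed
  show ?thesis unfolding nc_eval_det_poly[OF ws(1) s]
    using k by (intro det_dependent_rows[where a = "\<lambda>i. f (ws ! i)"] nc_polys_coeff f(1) word_eval_closed sj rel)
qed

text \<open>The two factors are put into disjoint blocks of variables, so that distinct pairs of
  monomials have distinct products. A product of nonzero coefficients is nonzero in a field, so
  \<open>h\<close> does not vanish.\<close>

lemma nc_poly_product:
  assumes f: "f \<in> nc_polys K" "f \<noteq> (\<lambda>w. \<zero>\<^bsub>K\<^esub>)" and g: "g \<in> nc_polys K" "g \<noteq> (\<lambda>w. \<zero>\<^bsub>K\<^esub>)"
  obtains h where "h \<in> nc_polys K" "h \<noteq> (\<lambda>w. \<zero>\<^bsub>K\<^esub>)"
    "\<And>s. range s \<subseteq> carrier A \<Longrightarrow>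
      nc_eval K A s h = nc_eval K A (block_subst s 0) f \<otimes>\<^bsub>A\<^esub> nc_eval K A (block_subst s 1) g"
proof
  define F where "F = {w. f w \<noteq> \<zero>\<^bsub>K\<^esub>}"
  define G where "G = {w. g w \<noteq> \<zero>\<^bsub>K\<^esub>}"
  define m where "m = (\<lambda>p. block_word 0 (fst p) @ block_word 1 (snd p))"
  define c where "c = (\<lambda>p. g (snd p) \<otimes>\<^bsub>K\<^esub> f (fst p))"
  have fin: "finite F" "finite G" using f g by (auto simp: F_def G_def nc_polys_finite)
  have inj: "inj_on m (F \<times> G)"
  proof (rule inj_onI)
    fix p q assume "m p = m q"
    \<comment> \<open>Keeping only block 0 or only block 1 recovers the two components of the
      pair.\<close>
    then have "filter (\<lambda>x. fst (prod_decode x) = j) (m p) = filter (\<lambda>x. fst (prod_decode x) = j) (m q)" for j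
      by simp
    from this[of 0] this[of 1] show "p = q"
      unfolding m_def filter_append filter_block_word by (simp add: block_word_inject prod_eq_iff)
  qed
  have c: "c p \<in> carrier K" for p using f g by (simp add: c_def nc_polys_coeff)
  obtain u v where uv: "u \<in> F" "v \<in> G"
    using f(2) g(2) by (auto simp: F_def G_def fun_eq_iff)
  have c0: "c (u, v) \<noteq> \<zero>\<^bsub>K\<^esub>"
    using uv integral[of "g v" "f u"] f g by (auto simp: c_def F_def G_def nc_polys_coeff)
  show "family_poly K (F \<times> G) m c \<in> nc_polys K"
    using fin c by (intro family_poly_in_nc_polys inj) auto
  show "family_poly K (F \<times> G) m c \<noteq> (\<lambda>w. \<zero>\<^bsub>K\<^esub>)"
    using uv c0 by (intro family_poly_nonzero[OF inj, where t = "(u, v)"]) auto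
  fix s :: "nat \<Rightarrow> 'c" assume s: "range s \<subseteq> carrier A"
  have sj: "range (block_subst s j) \<subseteq> carrier A" for j using s by auto
  let ?U = "\<lambda>u. f u \<odot>\<^bsub>A\<^esub> word_eval A (block_subst s 0) u"
  let ?V = "\<lambda>v. g v \<odot>\<^bsub>A\<^esub> word_eval A (block_subst s 1) v"
  have U: "?U u \<in> carrier A" and V: "?V u \<in> carrier A" for u
    using f g by (auto intro!: smult_closed nc_polys_coeff word_eval_closed sj)
  have ev: "word_eval A s (m p) =
      word_eval A (block_subst s 0) (fst p) \<otimes>\<^bsub>A\<^esub> word_eval A (block_subst s 1) (snd p)" for p
    unfolding m_def word_eval_append[OF s] word_eval_map by (simp add: comp_def)
  have "nc_eval K A s (family_poly K (F \<times> G) m c) =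
      (\<Oplus>\<^bsub>A\<^esub>p\<in>F \<times> G. c p \<odot>\<^bsub>A\<^esub> word_eval A s (m p))"
    using fin c by (intro nc_eval_family_poly inj s) auto
  also have "\<dots> = (\<Oplus>\<^bsub>A\<^esub>p\<in>F \<times> G. ?U (fst p) \<otimes>\<^bsub>A\<^esub> ?V (snd p))"
  proof (rule M.finsum_cong')
    fix p
    show "c p \<odot>\<^bsub>A\<^esub> word_eval A s (m p) = ?U (fst p) \<otimes>\<^bsub>A\<^esub> ?V (snd p)"
      using f g word_eval_closed[OF sj] unfolding ev c_def
      by (simp add: smult_mult_left smult_mult_right smult_assoc1 nc_polys_coeff)
  qed (use U V in auto)
  also have "\<dots> = (\<Oplus>\<^bsub>A\<^esub>u\<in>F. \<Oplus>\<^bsub>A\<^esub>v\<in>G. ?U u \<otimes>\<^bsub>A\<^esub> ?V v)"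
    using U V fin by (intro M.finsum_cartesian_product[where f = "\<lambda>u v. ?U u \<otimes>\<^bsub>A\<^esub> ?V v"]) auto
  also have "\<dots> = (\<Oplus>\<^bsub>A\<^esub>u\<in>F. ?U u \<otimes>\<^bsub>A\<^esub> (\<Oplus>\<^bsub>A\<^esub>v\<in>G. ?V v))"
    using U V fin by (intro M.finsum_cong' A.finsum_rdistr[symmetric] A.m_closed M.finsum_closed) auto
  also have "\<dots> = (\<Oplus>\<^bsub>A\<^esub>u\<in>F. ?U u) \<otimes>\<^bsub>A\<^esub> (\<Oplus>\<^bsub>A\<^esub>v\<in>G. ?V v)"
    using U V fin by (intro A.finsum_ldistr[symmetric] M.finsum_closed) auto
  finally show "nc_eval K A s (family_poly K (F \<times> G) m c) =
      nc_eval K A (block_subst s 0) f \<otimes>\<^bsub>A\<^esub> nc_eval K A (block_subst s 1) g"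
    by (simp add: nc_eval_def F_def G_def)
qed

section \<open>Identities of quotient algebras\<close>

lemma quot_add_coset:
  assumes "ideal I A" "x \<in> carrier A" "y \<in> carrier A"
  shows "(I +>\<^bsub>A\<^esub> x) \<oplus>\<^bsub>quot_algebra A I\<^esub> (I +>\<^bsub>A\<^esub> y) = I +>\<^bsub>A\<^esub> (x \<oplus>\<^bsub>A\<^esub> y)"
  using assms abelian_subgroup.a_rcos_sum[OF abelian_subgroupI3[OF ideal.axioms(1) A.is_abelian_group]]
  by (simp add: FactRing_def)

lemma quot_coset_closed: "x \<in> carrier A \<Longrightarrow> I +>\<^bsub>A\<^esub> x \<in> carrier (quot_algebra A I)"
  by (auto simp: FactRing_def A_RCOSETS_def')

lemma quot_nc_eval:
  assumes I: "ideal I A" and f: "f \<in> nc_polys K" and s: "range s \<subseteq> carrier A"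
  shows "nc_eval K (quot_algebra A I) (\<lambda>i. I +>\<^bsub>A\<^esub> s i) f = I +>\<^bsub>A\<^esub> nc_eval K A s f"
proof -
  let ?Q = "quot_algebra A I"
  note [simp del] = quot_algebra_simps
  interpret I: ideal I A by fact
  interpret Q: assoc_algebra K ?Q by (rule quot_algebra_assoc_algebra[OF I])
  have zero: "\<zero>\<^bsub>?Q\<^esub> = I +>\<^bsub>A\<^esub> \<zero>\<^bsub>A\<^esub>"
    by (simp add: quot_algebra_simps FactRing_def I.a_rcos_const)
  have word: "word_eval ?Q (\<lambda>i. I +>\<^bsub>A\<^esub> s i) w = I +>\<^bsub>A\<^esub> word_eval A s w" for w
  proof (induction w)
    case Nil
    then show ?case by (simp add: word_eval_def quot_algebra_simps FactRing_def)
  next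
    case (Cons a w)
    have "s a \<in> carrier A" using s by auto
    with Cons show ?case
      using word_eval_closed[OF s, of w]
      by (simp add: word_eval_def quot_algebra_simps FactRing_def I.rcoset_mult_add)
  qed
  have sum: "(\<Oplus>\<^bsub>?Q\<^esub>w\<in>W. I +>\<^bsub>A\<^esub> F w) = I +>\<^bsub>A\<^esub> (\<Oplus>\<^bsub>A\<^esub>w\<in>W. F w)"
    if "finite W" "\<And>w. F w \<in> carrier A" for W and F :: "nat list \<Rightarrow> 'c"
    using that(1)
  proof (induction W rule: finite_induct)
    case empty
    then show ?case by (simp add: zero)
  next
    case (insert w W)
    then show ?case
      using that(2) by (simp add: quot_coset_closed quot_add_coset[OF I] Pi_def)
  qed
  have "nc_eval K ?Q (\<lambda>i. I +>\<^bsub>A\<^esub> s i) f =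
      (\<Oplus>\<^bsub>?Q\<^esub>w\<in>{w. f w \<noteq> \<zero>\<^bsub>K\<^esub>}. I +>\<^bsub>A\<^esub> (f w \<odot>\<^bsub>A\<^esub> word_eval A s w))"
    unfolding nc_eval_def word
    using nc_polys_coeff[OF f] word_eval_closed[OF s] by (simp add: quot_smult_coset[OF I])
  also have "\<dots> = I +>\<^bsub>A\<^esub> nc_eval K A s f"
    unfolding nc_eval_def using nc_polys_coeff[OF f] word_eval_closed[OF s]
    by (intro sum nc_polys_finite[OF f]) auto
  finally show ?thesis .
qed

text \<open>Every substitution in the quotient lifts to representatives, and evaluation commutes
  with passing to cosets. Later arguments can thus stay inside \<open>A\<close> and speak of
  membership in \<open>I\<close>.\<close>

lemma quot_identity_iff:
  assumes I: "ideal I A" and f: "f \<in> nc_polys K"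
  shows "(\<forall>s. range s \<subseteq> carrier (quot_algebra A I) \<longrightarrow>
      nc_eval K (quot_algebra A I) s f = \<zero>\<^bsub>quot_algebra A I\<^esub>) \<longleftrightarrow>
    (\<forall>s. range s \<subseteq> carrier A \<longrightarrow> nc_eval K A s f \<in> I)" (is "?L \<longleftrightarrow> ?R")
proof -
  interpret I: ideal I A by fact
  have zero: "I +>\<^bsub>A\<^esub> x = \<zero>\<^bsub>quot_algebra A I\<^esub> \<longleftrightarrow> x \<in> I" if "x \<in> carrier A" for x
    using that by (auto simp: FactRing_def I.a_rcos_const dest: I.a_rcos_self)
  show ?thesis
  proof (intro iffI allI impI)
    fix s :: "nat \<Rightarrow> 'c" assume ?L and s: "range s \<subseteq> carrier A"
    then have "nc_eval K (quot_algebra A I) (\<lambda>i. I +>\<^bsub>A\<^esub> s i) f = \<zero>\<^bsub>quot_algebra A I\<^esub>"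
      using quot_coset_closed by (simp add: image_subset_iff del: quot_algebra_simps)
    then show "nc_eval K A s f \<in> I"
      using zero nc_eval_closed[OF f s] by (simp add: quot_nc_eval[OF I f s])
  next
    fix s :: "nat \<Rightarrow> 'c set" assume R: ?R and s: "range s \<subseteq> carrier (quot_algebra A I)"
    have "\<exists>x\<in>carrier A. s i = I +>\<^bsub>A\<^esub> x" for i
      using s by (auto simp: FactRing_def A_RCOSETS_def' image_subset_iff)
    then obtain t where t: "\<And>i. t i \<in> carrier A" "s = (\<lambda>i. I +>\<^bsub>A\<^esub> t i)"
      by metis
    then have rt: "range t \<subseteq> carrier A" by auto
    show "nc_eval K (quot_algebra A I) s f = \<zero>\<^bsub>quot_algebra A I\<^esub>"
      unfolding t(2) quot_nc_eval[OF I f rt]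
      using zero nc_eval_closed[OF f rt] R rt by simp
  qed
qed

text \<open>This is \<open>det_poly_identity\<close> in the quotient. The new identity remembers
  only a list of words containing the support of \<open>f\<close>, not its coefficients.\<close>

lemma det_poly_in_ideal:
  assumes I: "ideal I A" and ws: "distinct ws" "{w. f w \<noteq> \<zero>\<^bsub>K\<^esub>} \<subseteq> set ws"
    and f: "f \<in> nc_polys K" "f \<noteq> (\<lambda>w. \<zero>\<^bsub>K\<^esub>)"
    and ident: "\<forall>s. range s \<subseteq> carrier A \<longrightarrow> nc_eval K A s f \<in> I"
  shows "\<forall>s. range s \<subseteq> carrier A \<longrightarrow> nc_eval K A s (det_poly K ws) \<in> I"
proof -
  interpret Q: assoc_algebra K "quot_algebra A I" by (rule quot_algebra_assoc_algebra[OF I])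
  show ?thesis
    using Q.det_poly_identity[OF ws f] ident
    unfolding quot_identity_iff[OF I f(1), symmetric]
      quot_identity_iff[OF I det_poly_in_nc_polys[OF ws(1)], symmetric] by blast
qed

section \<open>Primeness of almost PI algebras\<close>

lemma almost_PI_quotD:
  assumes "almost_PI K A" "ideal I A" "I \<noteq> {\<zero>\<^bsub>A\<^esub>}"
  obtains f where "f \<in> nc_polys K" "f \<noteq> (\<lambda>w. \<zero>\<^bsub>K\<^esub>)"
    "\<forall>s. range s \<subseteq> carrier A \<longrightarrow> nc_eval K A s f \<in> I"
  using assms quot_identity_iff[OF assms(2)] unfolding almost_PI_def PI_algebra_def by metis

text \<open>If \<open>I\<close> and \<open>J\<close> are nonzero with product zero, take an identity
  modulo each. Their product in separate variables takes values in \<open>I \<cdot> J\<close>, hence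
  is a nonzero identity of \<open>A\<close>, a contradiction.\<close>

lemma almost_PI_zero_prime:
  assumes "almost_PI K A"
  shows "nc_prime_ideal {\<zero>\<^bsub>A\<^esub>} A"
  unfolding nc_prime_ideal_def
proof (intro conjI allI impI)
  show "ideal {\<zero>\<^bsub>A\<^esub>} A" by (rule A.zeroideal)
  have notPI: "\<not> PI_algebra K A" using assms by (simp add: almost_PI_def)
  show "{\<zero>\<^bsub>A\<^esub>} \<noteq> carrier A"
  proof
    assume "{\<zero>\<^bsub>A\<^esub>} = carrier A"
    \<comment> \<open>Over the zero ring every polynomial is an identity; the determinant of the
      single empty word serves as a nonzero one.\<close>
    moreover have "distinct [[] :: nat list]" by simp
    ultimately have "PI_algebra K A"
      unfolding PI_algebra_def using nc_eval_closed det_poly_in_nc_polys det_poly_nonzero by blast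
    with notPI show False ..
  qed
  fix I J assume IJ: "ideal I A \<and> ideal J A \<and> I \<cdot>\<^bsub>A\<^esub> J \<subseteq> {\<zero>\<^bsub>A\<^esub>}"
  show "I \<subseteq> {\<zero>\<^bsub>A\<^esub>} \<or> J \<subseteq> {\<zero>\<^bsub>A\<^esub>}"
  proof (rule ccontr)
    assume "\<not> (I \<subseteq> {\<zero>\<^bsub>A\<^esub>} \<or> J \<subseteq> {\<zero>\<^bsub>A\<^esub>})"
    then have ne: "I \<noteq> {\<zero>\<^bsub>A\<^esub>}" "J \<noteq> {\<zero>\<^bsub>A\<^esub>}" by auto
    obtain f where f: "f \<in> nc_polys K" "f \<noteq> (\<lambda>w. \<zero>\<^bsub>K\<^esub>)"
      "\<forall>s. range s \<subseteq> carrier A \<longrightarrow> nc_eval K A s f \<in> I"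
      using almost_PI_quotD[OF assms _ ne(1)] IJ by blast
    obtain g where g: "g \<in> nc_polys K" "g \<noteq> (\<lambda>w. \<zero>\<^bsub>K\<^esub>)"
      "\<forall>s. range s \<subseteq> carrier A \<longrightarrow> nc_eval K A s g \<in> J"
      using almost_PI_quotD[OF assms _ ne(2)] IJ by blast
    obtain h where h: "h \<in> nc_polys K" "h \<noteq> (\<lambda>w. \<zero>\<^bsub>K\<^esub>)"
      and eval: "\<And>s. range s \<subseteq> carrier A \<Longrightarrow>
        nc_eval K A s h = nc_eval K A (block_subst s 0) f \<otimes>\<^bsub>A\<^esub> nc_eval K A (block_subst s 1) g"
      using nc_poly_product[OF f(1,2) g(1,2)] by blast
    have "nc_eval K A s h = \<zero>\<^bsub>A\<^esub>" if s: "range s \<subseteq> carrier A" for s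
    proof -
      have sj: "range (block_subst s j) \<subseteq> carrier A" for j using s by auto
      have "nc_eval K A (block_subst s 0) f \<in> I" "nc_eval K A (block_subst s 1) g \<in> J"
        using f(3) g(3) sj by simp_all
      then have "nc_eval K A s h \<in> I \<cdot>\<^bsub>A\<^esub> J"
        unfolding eval[OF s] by (rule ideal_prod.prod)
      then have "nc_eval K A s h \<in> {\<zero>\<^bsub>A\<^esub>}" using IJ by (meson subsetD)
      then show ?thesis by simp
    qed
    then show False using notPI h unfolding PI_algebra_def by blast
  qed
qed

end

section \<open>Infinite families of primes under the chain condition\<close>

lemma nc_semiprime_ideal_Inter:
  assumes "ring R" "C \<noteq> {}" "\<And>P. P \<in> C \<Longrightarrow> nc_prime_ideal P R"
  shows "nc_semiprime_ideal (\<Inter>C) R"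
  unfolding nc_semiprime_ideal_def
proof (intro conjI allI impI)
  show "ideal (\<Inter>C) R"
    using assms by (intro ring.i_Intersect) (auto simp: nc_prime_ideal_def)
  fix I assume "ideal I R \<and> I \<cdot>\<^bsub>R\<^esub> I \<subseteq> \<Inter>C"
  then show "I \<subseteq> \<Inter>C"
    using assms(3) unfolding nc_prime_ideal_def by (metis Inter_greatest Inter_lower subset_trans)
qed

text \<open>A maximal member of the set of intersections of infinite subfamilies is prime: if \<open>I J\<close>
  lies in it, then infinitely many members of the subfamily contain \<open>I\<close>, or infinitely many
  contain \<open>J\<close>.\<close>

lemma acc_semiprime_infinite_primes:
  assumes R: "ring R" and acc: "acc_semiprime R"
    and S: "infinite S" "\<And>P. P \<in> S \<Longrightarrow> nc_prime_ideal P R"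
  obtains C where "C \<subseteq> S" "infinite C" "nc_prime_ideal (\<Inter>C) R"
proof -
  \<comment> \<open>Inclusion is reversed, so the chain condition says that \<open>r\<close> is
    well-founded and an \<open>r\<close>-minimal element is a maximal semiprime ideal of the
    family.\<close>
  define r where "r = {(B, A). nc_semiprime_ideal A R \<and> nc_semiprime_ideal B R \<and> A \<subset> B}"
  have wf: "wf r"
    unfolding wf_iff_no_infinite_down_chain
  proof
    assume "\<exists>Q. \<forall>i. (Q (Suc i), Q i) \<in> r"
    then obtain Q where Q: "\<And>i. (Q (Suc i), Q i) \<in> r" by blast
    then have "\<forall>n. nc_semiprime_ideal (Q n) R \<and> Q n \<subseteq> Q (Suc n)"
      by (auto simp: r_def)
    then obtain N where "\<forall>n\<ge>N. Q n = Q N"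
      using acc unfolding acc_semiprime_def by blast
    then have "Q (Suc N) = Q N" by (meson le_SucI order_refl)
    then show False using Q[of N] by (auto simp: r_def)
  qed
  have "\<Inter>S \<in> {\<Inter>C |C. C \<subseteq> S \<and> infinite C}" using S(1) by blast
  from wfE_min[OF wf this] obtain M where M: "M \<in> {\<Inter>C |C. C \<subseteq> S \<and> infinite C}"
    and max: "\<And>B. (B, M) \<in> r \<Longrightarrow> B \<notin> {\<Inter>C |C. C \<subseteq> S \<and> infinite C}" by blast
  then obtain C where C: "C \<subseteq> S" "infinite C" "M = \<Inter>C" by blast
  have semi: "nc_semiprime_ideal (\<Inter>D) R" if "D \<subseteq> S" "infinite D" for D
    using that S(2) by (intro nc_semiprime_ideal_Inter R) auto
  \<comment> \<open>Passing to an infinite subfamily can only enlarge the intersection, which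
    maximality of \<open>M\<close> forbids.\<close>
  have eq: "\<Inter>D = \<Inter>C" if D: "D \<subseteq> C" "infinite D" for D
  proof (rule ccontr)
    assume "\<Inter>D \<noteq> \<Inter>C"
    then have "\<Inter>C \<subset> \<Inter>D" using D by auto
    then have "(\<Inter>D, M) \<in> r" using semi[of D] semi[of C] C D by (auto simp: r_def)
    then show False using max C D by blast
  qed
  have "nc_prime_ideal (\<Inter>C) R"
    unfolding nc_prime_ideal_def
  proof (intro conjI allI impI)
    show "ideal (\<Inter>C) R" using semi C by (auto simp: nc_semiprime_ideal_def)
    obtain P where P: "P \<in> C" using C(2) by (metis finite.emptyI ex_in_conv)
    then have "ideal P R" "P \<noteq> carrier R"
      using S(2) C(1) unfolding nc_prime_ideal_def by blast+
    then have "P \<noteq> carrier R" "P \<subseteq> carrier R"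
      by (auto dest: ideal.Icarr)
    then show "\<Inter>C \<noteq> carrier R" using P by blast
    fix I J assume IJ: "ideal I R \<and> ideal J R \<and> I \<cdot>\<^bsub>R\<^esub> J \<subseteq> \<Inter>C"
    \<comment> \<open>Every member of \<open>C\<close> is prime and contains the product of
      \<open>I\<close> and \<open>J\<close>, so it contains one of them.\<close>
    have "C = {P \<in> C. I \<subseteq> P} \<union> {P \<in> C. J \<subseteq> P}"
      using IJ S(2) C(1) unfolding nc_prime_ideal_def by blast
    then have "infinite {P \<in> C. I \<subseteq> P} \<or> infinite {P \<in> C. J \<subseteq> P}"
      using C(2) by (metis finite_Un)
    then have "\<Inter>{P \<in> C. I \<subseteq> P} = \<Inter>C \<or> \<Inter>{P \<in> C. J \<subseteq> P} = \<Inter>C"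
      using eq by (metis (no_types, lifting) Collect_subset mem_Collect_eq subsetI)
    then show "I \<subseteq> \<Inter>C \<or> J \<subseteq> \<Inter>C" by blast
  qed
  with C show thesis using that by blast
qed

section \<open>Countability of the height one primes\<close>

lemma prime_height_one_no_chain:
  assumes "prime_height R P = 1" "nc_prime_ideal P R" "nc_prime_ideal Q R" "nc_prime_ideal Q' R"
    and "Q \<subset> P" "Q' \<subset> Q"
  shows False
proof -
  \<comment> \<open>Heights are computed from sequences indexed by all naturals; past index 2 the
    value \<open>Q'\<close> is mere padding.\<close>
  define C where "C = (\<lambda>i :: nat. if i = 0 then P else if i = 1 then Q else Q')"
  have "C 0 = P" "\<forall>i\<le>2. nc_prime_ideal (C i) R"
    using assms by (simp_all add: C_def)
  moreover have "\<forall>i<2. C (Suc i) \<subset> C i"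
    using assms(5,6) by (auto simp: C_def dest!: less_2_cases)
  ultimately have "enat 2 \<le> prime_height R P"
    unfolding prime_height_def by (intro Sup_upper) blast
  then show False using assms(1) by (simp add: one_enat_def)
qed

theorem proposition1p22:
  fixes K :: "('k, 'n) ring_scheme" and R :: "('k, 'r, 'm) module_scheme"
  assumes "assoc_algebra K R"
    and "almost_PI K R"
    and "acc_semiprime R"
  shows "countable {P. nc_prime_ideal P R \<and> prime_height R P = 1}"
proof -
  interpret assoc_algebra K R by fact
  \<comment> \<open>\<open>S ws\<close> collects the height one primes modulo which the determinant
    of \<open>ws\<close> is an identity.\<close>
  define S where "S = (\<lambda>ws. {P. nc_prime_ideal P R \<and> prime_height R P = 1 \<and>
    (\<forall>s. range s \<subseteq> carrier R \<longrightarrow> nc_eval K R s (det_poly K ws) \<in> P)})"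
  have fin: "finite (S ws)" if ws: "distinct ws" for ws
  proof (rule ccontr)
    assume "infinite (S ws)"
    from acc_semiprime_infinite_primes[OF A.ring_axioms assms(3) this] obtain C
      where C: "C \<subseteq> S ws" "infinite C" "nc_prime_ideal (\<Inter>C) R"
      by (auto simp: S_def)
    \<comment> \<open>An infinite family has a member different from its intersection, hence
      strictly above it.\<close>
    have "\<not> C \<subseteq> {\<Inter>C}" using C(2) finite_subset by blast
    then obtain P where P: "P \<in> C" "\<Inter>C \<subset> P" by blast
    have "\<Inter>C = {\<zero>\<^bsub>R\<^esub>}"
    proof (rule ccontr)
      assume "\<Inter>C \<noteq> {\<zero>\<^bsub>R\<^esub>}"
      moreover have "\<zero>\<^bsub>R\<^esub> \<in> \<Inter>C"
        using C(3) by (simp add: nc_prime_ideal_def additive_subgroup.zero_closed ideal.axioms(1) del: Inter_iff)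
      \<comment> \<open>Zero, the intersection and \<open>P\<close> would form a chain of three
        primes below a prime of height one.\<close>
      ultimately have "{\<zero>\<^bsub>R\<^esub>} \<subset> \<Inter>C" by blast
      then show False
        using prime_height_one_no_chain[OF _ _ C(3) almost_PI_zero_prime[OF assms(2)] P(2)] P(1) C(1)
        by (auto simp: S_def)
    qed
    then have "nc_eval K R s (det_poly K ws) = \<zero>\<^bsub>R\<^esub>" if "range s \<subseteq> carrier R" for s
      using that C(1) by (auto simp: S_def)
    then have "PI_algebra K R"
      unfolding PI_algebra_def using det_poly_in_nc_polys[OF ws] det_poly_nonzero[OF ws] by blast
    then show False using assms(2) by (simp add: almost_PI_def)
  qed
  \<comment> \<open>Adjoining the zero ideal as one extra point avoids computing its height.\<close>
  have "{P. nc_prime_ideal P R \<and> prime_height R P = 1} \<subseteq>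
      insert {\<zero>\<^bsub>R\<^esub>} (\<Union>ws\<in>{ws. distinct ws}. S ws)"
  proof
    fix P assume "P \<in> {P. nc_prime_ideal P R \<and> prime_height R P = 1}"
    then have P: "nc_prime_ideal P R" "prime_height R P = 1" and I: "ideal P R"
      by (auto simp: nc_prime_ideal_def)
    show "P \<in> insert {\<zero>\<^bsub>R\<^esub>} (\<Union>ws\<in>{ws. distinct ws}. S ws)"
    proof (cases "P = {\<zero>\<^bsub>R\<^esub>}")
      case False
      then obtain f where f: "f \<in> nc_polys K" "f \<noteq> (\<lambda>w. \<zero>\<^bsub>K\<^esub>)"
        "\<forall>s. range s \<subseteq> carrier R \<longrightarrow> nc_eval K R s f \<in> P"
        using almost_PI_quotD[OF assms(2) I] by blast
      \<comment> \<open>Only the support of \<open>f\<close> is kept; the coefficients may come from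
        an uncountable field.\<close>
      obtain ws where ws: "set ws = {w. f w \<noteq> \<zero>\<^bsub>K\<^esub>}" "distinct ws"
        using finite_distinct_list[OF nc_polys_finite[OF f(1)]] by blast
      have "P \<in> S ws"
        unfolding S_def using P det_poly_in_ideal[OF I ws(2) _ f] ws(1) by blast
      then show ?thesis using ws(2) by blast
    qed simp
  qed
  \<comment> \<open>There are only countably many lists of words over \<open>nat\<close>, and each
    \<open>S ws\<close> is finite.\<close>
  moreover have "countable (insert {\<zero>\<^bsub>R\<^esub>} (\<Union>ws\<in>{ws. distinct ws}. S ws))"
    using fin by (intro countable_insert countable_UN) (auto intro: countable_finite)
  ultimately show ?thesis by (rule countable_subset)
qed

end
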